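(* Let $G$ be the Gupta--Sidki $3$-group and let $H$ be a finitely generated subgroup of $G$. Then $H$ is finite if and only if no vertex section of $H$ is equal to $G$.
   Context: Let $T$ be the $3$-regular rooted tree: its vertices are the finite words over the alphabet $\{0,1,2\}$, the root is the empty word, and each word $u$ is joined by an edge to $ux$ for every letter $x$. $\mathrm{Aut}\,T$ is the group of root-preserving automorphisms of $T$, acting on the right, $v\mapsto v^g$. An automorphism $x$ fixing all three vertices of level $1$ is written $x=(x_0,x_1,x_2)$, where $x_i\in\mathrm{Aut}\,T$ is defined by $(iw)^x=i\,w^{x_i}$ for all words $w$. The Gupta--Sidki $3$-group is $G=\langle a,b\rangle\le \mathrm{Aut}\,T$, where $a$ is defined by $(iw)^a=(i+1 \bmod 3)w$ for every letter $i$ and word $w$, and $b$ is defined recursively by $b=(a,a^{-1},b)$. For a vertex $v$ of $T$ and $x\in\mathrm{Aut}\,T$ with $v^x=v$, let $x_v\in\mathrm{Aut}\,T$ be the automorphism defined by $(vw)^x=v\,w^{x_v}$ for all words $w$. For a subgroup $H\le\mathrm{Aut}\,T$, the vertex section of $H$ at $v$ is the subgroup $H_v=\{x_v : x\in H,\ v^x=v\}$ of $\mathrm{Aut}\,T$. Vertex sections are taken over all vertices $v$ of $T$. *)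

theory Defs
  imports "HOL-Algebra.Algebra" "HOL-Library.Numeral_Type"
begin

type_synonym vertex = "3 list"

definition tree_adj :: "vertex \<Rightarrow> vertex \<Rightarrow> bool" where
  "tree_adj u v \<longleftrightarrow> (\<exists>x. v = u @ [x]) \<or> (\<exists>x. u = v @ [x])"

text \<open>Automorphisms act on the right: the image of a vertex \<open>v\<close> under \<open>g\<close> is the function
  value \<open>g v\<close>, and in a product \<open>x \<otimes> y\<close> the factor \<open>x\<close> acts first.\<close>

definition Aut_T :: "(vertex \<Rightarrow> vertex) monoid" where
  "Aut_T = \<lparr>carrier = {f. bij f \<and> f [] = [] \<and> (\<forall>u v. tree_adj (f u) (f v) \<longleftrightarrow> tree_adj u v)},
            monoid.mult = (\<lambda>x y. y \<circ> x), monoid.one = id\<rparr>"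

text \<open>In the type \<open>3\<close>, addition is modulo 3.\<close>

fun gs_a :: "vertex \<Rightarrow> vertex" where
  "gs_a [] = []"
| "gs_a (i # w) = (i + 1) # w"

fun gs_b :: "vertex \<Rightarrow> vertex" where
  "gs_b [] = []"
| "gs_b (i # w) = i # (if i = 0 then gs_a w
                       else if i = 1 then (inv\<^bsub>Aut_T\<^esub> gs_a) w
                       else gs_b w)"

definition Gupta_Sidki :: "(vertex \<Rightarrow> vertex) set" where
  "Gupta_Sidki = generate Aut_T {gs_a, gs_b}"

text \<open>Meaningful only when \<open>x v = v\<close>; see \<open>section_at_spec\<close> and
  \<open>section_at_unique\<close>.\<close>

definition section_at :: "(vertex \<Rightarrow> vertex) \<Rightarrow> vertex \<Rightarrow> (vertex \<Rightarrow> vertex)" where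
  "section_at x v = (\<lambda>w. drop (length v) (x (v @ w)))"

definition vertex_section :: "(vertex \<Rightarrow> vertex) set \<Rightarrow> vertex \<Rightarrow> (vertex \<Rightarrow> vertex) set" where
  "vertex_section H v = {section_at x v | x. x \<in> H \<and> x v = v}"

definition finitely_generated_subgroup :: "'a set \<Rightarrow> ('a, 'b) monoid_scheme \<Rightarrow> bool" where
  "finitely_generated_subgroup H G \<longleftrightarrow>
     subgroup H G \<and> (\<exists>S. finite S \<and> S \<subseteq> H \<and> generate G S = H)"

lemma Aut_T_simps [simp]:
  "f \<in> carrier Aut_T \<longleftrightarrow>
     bij f \<and> f [] = [] \<and> (\<forall>u v. tree_adj (f u) (f v) \<longleftrightarrow> tree_adj u v)"
  "x \<otimes>\<^bsub>Aut_T\<^esub> y = y \<circ> x"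
  "\<one>\<^bsub>Aut_T\<^esub> = id"
  by (simp_all add: Aut_T_def)

lemma surj_I: "(\<And>v. \<exists>u. f u = v) \<Longrightarrow> surj f"
  by (metis surj_def)

lemma group_Aut_T: "group Aut_T"
proof (rule groupI)
  fix f assume f: "f \<in> carrier Aut_T"
  then have b: "bij f" by simp
  let ?g = "inv_into UNIV f"
  have fg: "f (?g u) = u" for u using b by (simp add: bij_is_surj surj_f_inv_f)
  have gf: "?g (f u) = u" for u using b by (simp add: bij_is_inj)
  have "?g \<in> carrier Aut_T"
  proof -
    have "?g [] = []" using f gf[of "[]"] by simp
    moreover have "tree_adj (?g u) (?g v) \<longleftrightarrow> tree_adj u v" for u v
      using f fg by (metis Aut_T_simps(1))
    ultimately show ?thesis using b by (simp add: bij_imp_bij_inv)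
  qed
  moreover have "?g \<otimes>\<^bsub>Aut_T\<^esub> f = \<one>\<^bsub>Aut_T\<^esub>" using fg by (auto simp: fun_eq_iff)
  ultimately show "\<exists>y\<in>carrier Aut_T. y \<otimes>\<^bsub>Aut_T\<^esub> f = \<one>\<^bsub>Aut_T\<^esub>" by blast
qed (auto simp: bij_comp comp_assoc)

lemma Aut_T_step:
  assumes "f \<in> carrier Aut_T"
  shows "\<exists>y. f (u @ [x]) = f u @ [y]"
proof (induction u arbitrary: x rule: rev_induct)
  case Nil
  have "tree_adj [] [x]" by (simp add: tree_adj_def)
  then have "tree_adj [] (f [x])" using assms by (metis Aut_T_simps(1))
  then show ?case using assms by (simp add: tree_adj_def)
next
  case (snoc z u)
  have "tree_adj (u @ [z]) ((u @ [z]) @ [x])" unfolding tree_adj_def by blast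
  then have "tree_adj (f (u @ [z])) (f ((u @ [z]) @ [x]))" using assms by (metis Aut_T_simps(1))
  moreover have "f (u @ [z]) \<noteq> f ((u @ [z]) @ [x]) @ [y]" for y
  proof
    assume *: "f (u @ [z]) = f ((u @ [z]) @ [x]) @ [y]"
    obtain z' where "f (u @ [z]) = f u @ [z']" using snoc.IH by blast
    with * have "f u = f ((u @ [z]) @ [x])" by simp
    moreover have "inj f" using assms by (simp add: bij_is_inj)
    ultimately have "u = (u @ [z]) @ [x]" by (rule injD[rotated])
    then show False by simp
  qed
  ultimately show ?case unfolding tree_adj_def by blast
qed

lemma Aut_T_append:
  assumes "f \<in> carrier Aut_T"
  shows "\<exists>w'. length w' = length w \<and> f (v @ w) = f v @ w'"
proof (induction w rule: rev_induct)
  case (snoc x w)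
  then obtain w' where "length w' = length w" "f (v @ w) = f v @ w'" by blast
  moreover obtain y where "f ((v @ w) @ [x]) = f (v @ w) @ [y]"
    using Aut_T_step[OF assms] by blast
  ultimately show ?case by (intro exI[of _ "w' @ [y]"]) simp
qed simp

lemma section_at_spec:
  assumes "x \<in> carrier Aut_T" "x v = v"
  shows "x (v @ w) = v @ section_at x v w"
  using Aut_T_append[OF assms(1), of w v] assms(2) by (auto simp: section_at_def)

lemma section_at_unique:
  assumes "\<And>w. x (v @ w) = v @ y w"
  shows "section_at x v = y"
  using assms by (simp add: section_at_def)

lemma section_at_closed:
  assumes x: "x \<in> carrier Aut_T" and v: "x v = v"
  shows "section_at x v \<in> carrier Aut_T"
proof -
  have s: "x (v @ w) = v @ section_at x v w" for w using section_at_spec[OF assms] .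
  have bx: "bij x" using x by simp
  have "inj (section_at x v)"
    by (rule injI) (smt (verit) s bx bij_is_inj injD same_append_eq)
  moreover have "surj (section_at x v)"
  proof (rule surj_I)
    fix w
    obtain u where u: "x u = v @ w" using bx by (metis bij_pointE)
    have len: "length (x u') = length u'" for u'
      using Aut_T_append[OF x, of u' "[]"] x by auto
    have "length v \<le> length u" using len[of u] u by simp
    have "\<exists>w'. x (take (length v) u @ drop (length v) u) = x (take (length v) u) @ w'"
      using Aut_T_append[OF x] by blast
    then obtain w' where "v @ w = x (take (length v) u) @ w'" using u by auto
    moreover have "length (x (take (length v) u)) = length v"
      using len \<open>length v \<le> length u\<close> by simp
    ultimately have "x (take (length v) u) = x v" using v by simp
    then have "take (length v) u = v" using bx by (metis bij_is_inj injD)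
    then have "u = v @ drop (length v) u" by (metis append_take_drop_id)
    then have "section_at x v (drop (length v) u) = w" using u s by (metis same_append_eq)
    then show "\<exists>y. section_at x v y = w" by blast
  qed
  moreover have "section_at x v [] = []" using v by (simp add: section_at_def)
  moreover have "tree_adj (section_at x v p) (section_at x v q) \<longleftrightarrow> tree_adj p q" for p q
  proof -
    have ad: "tree_adj (v @ p) (v @ q) \<longleftrightarrow> tree_adj p q" for p q by (simp add: tree_adj_def)
    show ?thesis using x ad s by (metis Aut_T_simps(1))
  qed
  ultimately show ?thesis by (simp add: bij_def)
qed

lemma Aut_T_I:
  assumes b: "bij f" and nil: "f [] = []" and app: "\<And>u x. \<exists>y. f (u @ [x]) = f u @ [y]"
  shows "f \<in> carrier Aut_T"
proof -
  have inj: "inj f" using b by (simp add: bij_is_inj)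
  have len: "length (f u) = length u" for u
  proof (induction u rule: rev_induct)
    case (snoc x u)
    then show ?case using app[of u x] by auto
  qed (simp add: nil)
  have fwd: "(\<exists>y. v = u @ [y]) \<longleftrightarrow> (\<exists>y. f v = f u @ [y])" for u v
  proof
    assume "\<exists>y. f v = f u @ [y]"
    then obtain y where y: "f v = f u @ [y]" by blast
    then have "length v = Suc (length u)" using len[of v] len[of u] by simp
    then obtain v' x where v: "v = v' @ [x]" by (cases v rule: rev_cases) auto
    obtain z where "f v = f v' @ [z]" using app v by blast
    with y have "f v' = f u" by simp
    then have "v' = u" using inj by (simp add: inj_eq)
    with v show "\<exists>y. v = u @ [y]" by blast
  qed (use app in blast)
  show ?thesis using b nil fwd by (simp add: tree_adj_def)
qed

lemma gs_a_in_Aut_T: "gs_a \<in> carrier Aut_T"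
proof -
  have append: "\<exists>y. gs_a (u @ [x]) = gs_a u @ [y]" for u x by (cases u) auto
  have inj: "inj gs_a"
  proof (rule injI)
    show "gs_a u = gs_a v \<Longrightarrow> u = v" for u v by (cases u; cases v) auto
  qed
  have "surj gs_a"
  proof (rule surj_I)
    show "\<exists>u. gs_a u = v" for v
      by (cases v) (auto intro: exI[of _ "[]"] exI[of _ "(hd v - 1) # tl v"])
  qed
  with inj append show ?thesis by (intro Aut_T_I) (auto simp: bij_def)
qed

lemma gs_b_in_Aut_T: "gs_b \<in> carrier Aut_T"
proof -
  have c: "inv\<^bsub>Aut_T\<^esub> gs_a \<in> carrier Aut_T"
    using gs_a_in_Aut_T group.inv_closed[OF group_Aut_T] by blast
  have append: "\<exists>y. gs_b (u @ [x]) = gs_b u @ [y]" for u x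
  proof (induction u)
    case Nil
    have "\<exists>y. f [x] = f [] @ [y]" if "f \<in> carrier Aut_T" for f
      using Aut_T_step[OF that, of "[]" x] by simp
    then show ?case using c gs_a_in_Aut_T by simp
  next
    case (Cons i u)
    then show ?case
      using Aut_T_step[OF c, of u x] Aut_T_step[OF gs_a_in_Aut_T, of u x] by simp
  qed
  have ia: "inj gs_a" "inj (inv\<^bsub>Aut_T\<^esub> gs_a)" and sa: "surj gs_a" "surj (inv\<^bsub>Aut_T\<^esub> gs_a)"
    using c gs_a_in_Aut_T by (auto simp: bij_def)
  have "gs_b u = gs_b v \<Longrightarrow> u = v" for u v
  proof (induction u arbitrary: v)
    case Nil
    then show ?case by (cases v) auto
  next
    case (Cons i u)
    then show ?case
      by (cases v) (auto split: if_splits dest: injD[OF ia(1)] injD[OF ia(2)])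
  qed
  then have "inj gs_b" by (rule injI)
  moreover have "\<exists>u. gs_b u = v" for v
  proof (induction v)
    case Nil
    show ?case by (rule exI[of _ "[]"]) simp
  next
    case (Cons i v)
    obtain p q r where "gs_a p = v" "(inv\<^bsub>Aut_T\<^esub> gs_a) q = v" "gs_b r = v"
      using sa Cons by (metis surjD)
    then show ?case
      by (intro exI[of _ "i # (if i = 0 then p else if i = 1 then q else r)"]) simp
  qed
  then have "surj gs_b" by (rule surj_I)
  ultimately show ?thesis using append by (intro Aut_T_I) (auto simp: bij_def)
qed

lemma gs_b_decomposition:
  "section_at gs_b [0] = gs_a"
  "section_at gs_b [1] = inv\<^bsub>Aut_T\<^esub> gs_a"
  "section_at gs_b [2] = gs_b"
  by (simp_all add: section_at_def fun_eq_iff)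

lemma subgroup_Gupta_Sidki: "subgroup Gupta_Sidki Aut_T"
  unfolding Gupta_Sidki_def
  using group.generate_is_subgroup[OF group_Aut_T] gs_a_in_Aut_T gs_b_in_Aut_T by simp

end

theory Submission
  imports Defs
begin

text \<open>Let \<open>H\<close> be finitely generated and infinite. The sections of generators of \<open>H\<close> label the
  edges of the Schreier graph of \<open>H\<close> on a level of the tree, and the section of \<open>H\<close> at a vertex
  consists of the labels of the loops there. Since each letter \<open>b\<close> has the sections
  \<open>a, a\<^sup>-\<^sup>1, b\<close>, the total number of letters \<open>b\<close> on a component does not grow from one level to
  the next. An infinite section \<open>K\<close> for which this number is minimal acts transitively on the
  first level, since otherwise its infinite first-level section would lie in \<open>\<langle>b\<rangle>\<close>; the same
  holds for some section \<open>K\<^sub>i\<close>. Comparing exponent sums, \<open>K\<close> or \<open>K\<^sub>i\<close> maps onto the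
  abelianization of \<open>G\<close>, a property inherited by sections. Counting letters \<open>b\<close> once more,
  further sections contain \<open>b\<close> together with a conjugate \<open>g a g\<^sup>-\<^sup>1\<close>, and \<open>g\<close> is shortened
  until \<open>a\<close> itself is reached. Conversely \<open>G\<close> is infinite, as its proper subgroup fixing the
  first level maps onto \<open>G\<close>.\<close>

subsection \<open>Words in the generators and their sections\<close>

lemma three_cases: "(i::3) = 0 \<or> i = 1 \<or> i = 2"
proof -
  obtain z where z: "i = of_int z" "0 \<le> z" "z < 3" by (cases i rule: bit1_cases) simp
  then have "z = 0 \<or> z = 1 \<or> z = 2" by linarith
  with z(1) show ?thesis by auto
qed

lemma UNIV_three: "(UNIV :: 3 set) = {0, 1, 2}"
proof (rule UNIV_eq_I)
  show "i \<in> {0, 1, 2}" for i :: 3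
    using three_cases[of i] by simp
qed

lemma sum_three: "(\<Sum>i\<in>(UNIV::3 set). f i) = f 0 + f 1 + f 2" for f :: "3 \<Rightarrow> 'a::comm_monoid_add"
proof -
  have "(\<Sum>i\<in>(UNIV::3 set). f i) = (\<Sum>i\<in>{0, 1, 2}. f i)"
    by (rule arg_cong[OF UNIV_three])
  also have "\<dots> = f 0 + f 1 + f 2"
    by (simp add: add.assoc)
  finally show ?thesis .
qed

lemma sum_shift: "(\<Sum>i\<in>UNIV. f (i + c)) = (\<Sum>i\<in>(UNIV::3 set). f i)"
  by (rule sum.reindex_bij_betw) (rule bij_plus_right)

lemma minus_one_three: "- 1 = (2::3)"
  by simp

lemma three_eq_zero: "3 = (0::3)"
  by simp

lemma four_three: "4 = (1::3)"
  by simp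

lemma three_times: "(x::3) + x + x = 0"
  using three_cases[of x] by (elim disjE) simp_all

lemma UNIV_three_orbit:
  assumes "k \<noteq> (0::3)"
  shows "UNIV = {i, i + k, i + (k + k)}" "i \<noteq> i + k" "i \<noteq> i + (k + k)" "i + k \<noteq> i + (k + k)"
proof -
  have kk: "k + k \<noteq> 0" using three_cases[of k] assms by (elim disjE) simp_all
  show ne: "i \<noteq> i + k" "i \<noteq> i + (k + k)" "i + k \<noteq> i + (k + k)"
    using assms kk by simp_all
  show "UNIV = {i, i + k, i + (k + k)}"
  proof (rule UNIV_eq_I)
    fix j
    have "j - i = 0 \<or> j - i = k \<or> j - i = k + k"
      using three_cases[of k] three_cases[of "j - i"] assms by (elim disjE) simp_all
    then show "j \<in> {i, i + k, i + (k + k)}" by (auto simp: diff_eq_eq add.commute)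
  qed
qed

text \<open>A nonzero \<open>k\<close> generates Z/3, so the indices run through all letters. This
  turns a cube \<open>x @ x @ x\<close> into a sum over all sections of \<open>x\<close>.\<close>

lemma sum_three_orbit:
  fixes f :: "3 \<Rightarrow> 'a::comm_monoid_add"
  assumes "k \<noteq> 0"
  shows "f i + (f (i + k) + f (i + (k + k))) = (\<Sum>j\<in>UNIV. f j)"
proof -
  have "(\<Sum>j\<in>UNIV. f j) = (\<Sum>j\<in>{i, i + k, i + (k + k)}. f j)"
    by (rule arg_cong[OF UNIV_three_orbit(1)[OF assms]])
  also have "\<dots> = f i + (f (i + k) + f (i + (k + k)))"
    using UNIV_three_orbit(2-4)[OF assms, of i] by (simp del: add_left_cancel add_cancel_left_right)
  finally show ?thesis by (rule sym)
qed

section \<open>Powers of the generators and words in them\<close>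

fun apow :: "3 \<Rightarrow> vertex \<Rightarrow> vertex" where
  "apow k [] = []"
| "apow k (i # v) = (i + k) # v"

fun bpow :: "3 \<Rightarrow> vertex \<Rightarrow> vertex" where
  "bpow e [] = []"
| "bpow e (i # v) = i # (if i = 0 then apow e v else if i = 1 then apow (- e) v else bpow e v)"

lemma apow_add: "apow l (apow k v) = apow (k + l) v"
  by (cases v) (simp_all add: add.assoc)

lemma apow_zero [simp]: "apow 0 v = v"
  by (cases v) simp_all

lemma bpow_add: "bpow l (bpow k v) = bpow (k + l) v"
  by (induction v) (simp_all add: apow_add)

lemma bpow_zero [simp]: "bpow 0 v = v"
  by (induction v) simp_all

lemma gs_a_eq_apow: "gs_a = apow 1"
proof
  show "gs_a v = apow 1 v" for v by (cases v) simp_all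
qed

lemma inv_gs_a_eq_apow: "inv\<^bsub>Aut_T\<^esub> gs_a = apow (- 1)"
proof -
  interpret group Aut_T by (rule group_Aut_T)
  have eq: "apow (- 1) = gs_a \<circ> gs_a"
    by (simp add: gs_a_eq_apow apow_add fun_eq_iff minus_one_three)
  then have "apow (- 1) \<in> carrier Aut_T"
    using m_closed[OF gs_a_in_Aut_T gs_a_in_Aut_T] by (simp del: Aut_T_simps(1))
  moreover have "apow (- 1) \<otimes>\<^bsub>Aut_T\<^esub> gs_a = \<one>\<^bsub>Aut_T\<^esub>"
    by (auto simp: gs_a_eq_apow apow_add fun_eq_iff)
  ultimately show ?thesis
    using inv_equality gs_a_in_Aut_T by blast
qed

lemma gs_b_eq_bpow: "gs_b = bpow 1"
proof
  show "gs_b v = bpow 1 v" for v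
    by (induction v) (simp_all add: gs_a_eq_apow inv_gs_a_eq_apow[unfolded gs_a_eq_apow])
qed

datatype letter = La 3 | Lb 3

type_synonym gs_word = "letter list"

text \<open>A section of a word has exactly one letter for each letter of the word, possibly
  \<open>La 0\<close>; this makes taking sections commute literally with inversion of words.\<close>

fun letter_val :: "letter \<Rightarrow> vertex \<Rightarrow> vertex" where
  "letter_val (La k) = apow k"
| "letter_val (Lb e) = bpow e"

fun letter_inv :: "letter \<Rightarrow> letter" where
  "letter_inv (La k) = La (- k)"
| "letter_inv (Lb e) = Lb (- e)"

fun letter_section :: "letter \<Rightarrow> 3 \<Rightarrow> letter" where
  "letter_section (La k) i = La 0"
| "letter_section (Lb e) i = (if i = 0 then La e else if i = 1 then La (- e) else Lb e)"

fun letter_aexp :: "letter \<Rightarrow> 3" where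
  "letter_aexp (La k) = k"
| "letter_aexp (Lb e) = 0"

fun letter_bexp :: "letter \<Rightarrow> 3" where
  "letter_bexp (La k) = 0"
| "letter_bexp (Lb e) = e"

text \<open>\<open>Lb 0\<close> is counted too: the length belongs to the word and may differ for
  two words with the same value.\<close>

fun letter_blen :: "letter \<Rightarrow> nat" where
  "letter_blen (La k) = 0"
| "letter_blen (Lb e) = 1"

primrec word_val :: "gs_word \<Rightarrow> vertex \<Rightarrow> vertex" where
  "word_val [] = id"
| "word_val (l # w) = word_val w \<circ> letter_val l"

definition word_inv :: "gs_word \<Rightarrow> gs_word" where
  "word_inv w = rev (map letter_inv w)"

primrec word_section :: "gs_word \<Rightarrow> 3 \<Rightarrow> gs_word" where
  "word_section [] i = []"
| "word_section (l # w) i = letter_section l i # word_section w (i + letter_aexp l)"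

definition aexp :: "gs_word \<Rightarrow> 3" where
  "aexp w = sum_list (map letter_aexp w)"

definition bexp :: "gs_word \<Rightarrow> 3" where
  "bexp w = sum_list (map letter_bexp w)"

definition blen :: "gs_word \<Rightarrow> nat" where
  "blen w = sum_list (map letter_blen w)"

lemma exp_simps [simp]:
  "aexp [] = 0" "aexp (l # w) = letter_aexp l + aexp w" "aexp (u @ w) = aexp u + aexp w"
  "bexp [] = 0" "bexp (l # w) = letter_bexp l + bexp w" "bexp (u @ w) = bexp u + bexp w"
  "blen [] = 0" "blen (l # w) = letter_blen l + blen w" "blen (u @ w) = blen u + blen w"
  by (simp_all add: aexp_def bexp_def blen_def)

lemma word_inv_simps [simp]:
  "word_inv [] = []" "word_inv (l # w) = word_inv w @ [letter_inv l]"
  by (simp_all add: word_inv_def)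

lemma word_inv_append [simp]: "word_inv (u @ w) = word_inv w @ word_inv u"
  by (simp add: word_inv_def)

lemma letter_inv_inv [simp]: "letter_inv (letter_inv l) = l"
  by (cases l) simp_all

lemma word_inv_inv [simp]: "word_inv (word_inv w) = w"
  by (simp add: word_inv_def rev_map o_def)

lemma letter_inv_exp [simp]:
  "letter_aexp (letter_inv l) = - letter_aexp l" "letter_bexp (letter_inv l) = - letter_bexp l"
  "letter_blen (letter_inv l) = letter_blen l"
  by (cases l; simp)+

lemma word_inv_exp [simp]:
  "aexp (word_inv w) = - aexp w" "bexp (word_inv w) = - bexp w" "blen (word_inv w) = blen w"
  by (induction w) simp_all

lemma word_val_append [simp]: "word_val (u @ w) = word_val w \<circ> word_val u"
  by (induction u) (simp_all add: o_assoc)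

lemma letter_val_inv: "letter_val (letter_inv l) (letter_val l v) = v"
  by (cases l) (simp_all add: apow_add bpow_add)

lemma word_val_inv: "word_val (word_inv w) (word_val w v) = v"
  by (induction w arbitrary: v) (simp_all add: letter_val_inv)

lemma word_val_inv': "word_val w (word_val (word_inv w) v) = v"
  using word_val_inv[of "word_inv w"] by simp

lemma word_section_append [simp]:
  "word_section (u @ w) i = word_section u i @ word_section w (i + aexp u)"
  by (induction u arbitrary: i) (simp_all add: add.assoc)

lemma letter_section_inv:
  "letter_section (letter_inv l) (i + letter_aexp l) = letter_inv (letter_section l i)"
  by (cases l) simp_all

lemma word_section_inv: "word_section (word_inv w) (i + aexp w) = word_inv (word_section w i)"
proof (induction w arbitrary: i)
  case (Cons l w)
  have "word_section (word_inv w) (i + (letter_aexp l + aexp w))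
      = word_inv (word_section w (i + letter_aexp l))"
    using Cons[of "i + letter_aexp l"] by (simp add: add.assoc)
  then show ?case by (simp add: letter_section_inv add.assoc)
qed simp

lemma letter_val_Cons:
  "letter_val l (i # v) = (i + letter_aexp l) # letter_val (letter_section l i) v"
  by (cases l) simp_all

lemma word_val_Nil [simp]: "word_val w [] = []"
proof (induction w)
  case (Cons l w)
  then show ?case by (cases l) simp_all
qed simp

text \<open>A word translates first letters by a constant, so an element fixing one vertex of level
  1 fixes all three. \<open>word_section w i\<close> makes sense for every \<open>w\<close>, but
  gives a vertex section of the automorphism only when \<open>aexp w = 0\<close>.\<close>

lemma word_val_Cons: "word_val w (i # v) = (i + aexp w) # word_val (word_section w i) v"
  by (induction w arbitrary: i v) (simp_all add: letter_val_Cons add.assoc)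

text \<open>At each position of \<open>w\<close> the letter reached is a translate of the starting
  letter \<open>i\<close>, so exactly one start meets a given \<open>Lb\<close> at 2 and keeps it.
  The same count, weighted by exponents, gives \<open>sum_bexp_section\<close>.\<close>

lemma sum_blen_section: "(\<Sum>i\<in>UNIV. blen (word_section w i)) = blen w"
proof (induction w)
  case (Cons l w)
  have "(\<Sum>i\<in>UNIV. blen (word_section w (i + letter_aexp l))) = blen w"
    using Cons sum_shift[of "\<lambda>i. blen (word_section w i)" "letter_aexp l"] by (rule trans[rotated])
  moreover have "(\<Sum>i\<in>UNIV. letter_blen (letter_section l i)) = letter_blen l"
    by (cases l) (simp_all add: sum_three)
  ultimately show ?case by (simp add: sum.distrib)
qed simp

lemma sum_bexp_section: "(\<Sum>i\<in>UNIV. bexp (word_section w i)) = bexp w"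
proof (induction w)
  case (Cons l w)
  have "(\<Sum>i\<in>UNIV. bexp (word_section w (i + letter_aexp l))) = bexp w"
    using Cons sum_shift[of "\<lambda>i. bexp (word_section w i)" "letter_aexp l"] by (rule trans[rotated])
  moreover have "(\<Sum>i\<in>UNIV. letter_bexp (letter_section l i)) = letter_bexp l"
    by (cases l) (simp_all add: sum_three)
  ultimately show ?case by (simp add: sum.distrib)
qed simp

text \<open>A letter \<open>b\<close> whose section at \<open>i\<close> is \<open>a\<close> has section \<open>b\<close> at \<open>i + 2\<close>, and one whose
  section at \<open>i\<close> is \<open>a\<inverse>\<close> has section \<open>b\<close> at \<open>i + 1\<close>.\<close>

lemma aexp_section:
  "aexp (word_section w i) = bexp (word_section w (i + 2)) - bexp (word_section w (i + 1))"
proof (induction w arbitrary: i)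
  case (Cons l w)
  have "letter_aexp (letter_section l i)
      = letter_bexp (letter_section l (i + 2)) - letter_bexp (letter_section l (i + 1))"
    using three_cases[of i] by (cases l) auto
  with Cons[of "i + letter_aexp l"] show ?case by (simp add: ac_simps)
qed simp

lemma sum_aexp_section: "(\<Sum>i\<in>UNIV. aexp (word_section w i)) = 0"
  by (simp add: sum_three aexp_section four_three)

lemma blen_section_le: "blen (word_section w i) \<le> blen w"
  using member_le_sum[of i UNIV "\<lambda>i. blen (word_section w i)"] by (simp add: sum_blen_section)

text \<open>No \<open>Lb\<close> is lost to another section, so each is met at 2, where it is its
  own section, while every \<open>La\<close> contributes \<open>La 0\<close>. A product of powers of
  \<open>b\<close> remains.\<close>

lemma word_val_section_if_blen_eq:
  assumes "blen (word_section w i) = blen w"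
  shows "word_val (word_section w i) = bpow (bexp w)"
  using assms
proof (induction w arbitrary: i)
  case (Cons l w)
  have 1: "letter_blen (letter_section l i) \<le> letter_blen l" by (cases l) simp_all
  with Cons.prems blen_section_le[of w "i + letter_aexp l"]
  have 2: "letter_blen (letter_section l i) = letter_blen l"
    "blen (word_section w (i + letter_aexp l)) = blen w" by simp_all
  then have "letter_val (letter_section l i) = bpow (letter_bexp l)"
    by (cases l) (auto split: if_splits)
  with Cons.IH[OF 2(2)] show ?case by (auto simp: bpow_add)
qed auto

lemma word_val_if_blen_zero: "blen w = 0 \<Longrightarrow> word_val w = apow (aexp w)"
proof (induction w)
  case (Cons l w)
  then show ?case by (cases l) (auto simp: apow_add)
qed auto

subsection \<open>Vertex sections of subgroups\<close>

lemma aexp_eq_if_word_val_eq: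
  assumes "word_val u = word_val w"
  shows "aexp u = aexp w"
  using fun_cong[OF assms, of "[0]"] by (simp add: word_val_Cons)

lemma word_val_section_cong:
  assumes "word_val u = word_val w"
  shows "word_val (word_section u i) = word_val (word_section w i)"
proof
  show "word_val (word_section u i) v = word_val (word_section w i) v" for v
    using fun_cong[OF assms, of "i # v"] by (simp add: word_val_Cons)
qed

lemma word_val_eqI:
  assumes "aexp u = aexp w" "\<And>i. word_val (word_section u i) = word_val (word_section w i)"
  shows "word_val u = word_val w"
proof
  show "word_val u v = word_val w v" for v
    using assms by (cases v) (simp_all add: word_val_Cons)
qed

lemma letter_val_in_Gupta_Sidki: "letter_val l \<in> Gupta_Sidki"
proof -
  interpret S: subgroup Gupta_Sidki Aut_T by (rule subgroup_Gupta_Sidki)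
  have comp: "y \<circ> x \<in> Gupta_Sidki" if "x \<in> Gupta_Sidki" "y \<in> Gupta_Sidki" for x y
    using S.m_closed[OF that] by simp
  have id: "id \<in> Gupta_Sidki" using S.one_closed by (simp only: Aut_T_simps)
  have a: "gs_a \<in> Gupta_Sidki" and b: "gs_b \<in> Gupta_Sidki"
    unfolding Gupta_Sidki_def by (auto intro: generate.incl)
  have "apow 0 = id" "apow 2 = gs_a \<circ> gs_a" "bpow 0 = id" "bpow 2 = gs_b \<circ> gs_b"
    by (auto simp: gs_a_eq_apow gs_b_eq_bpow apow_add bpow_add fun_eq_iff)
  then have "apow 0 \<in> Gupta_Sidki" "apow 1 \<in> Gupta_Sidki" "apow 2 \<in> Gupta_Sidki"
    "bpow 0 \<in> Gupta_Sidki" "bpow 1 \<in> Gupta_Sidki" "bpow 2 \<in> Gupta_Sidki"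
    using id a b comp[OF a a] comp[OF b b] by (simp_all only: gs_a_eq_apow gs_b_eq_bpow)
  then have "apow k \<in> Gupta_Sidki" "bpow k \<in> Gupta_Sidki" for k
    using three_cases[of k] by auto
  then show ?thesis by (cases l) simp_all
qed

lemma word_val_in_Gupta_Sidki: "word_val w \<in> Gupta_Sidki"
proof (induction w)
  case Nil
  show ?case using subgroup.one_closed[OF subgroup_Gupta_Sidki] by (simp add: id_def)
next
  case (Cons l w)
  show ?case
    using subgroup.m_closed[OF subgroup_Gupta_Sidki letter_val_in_Gupta_Sidki Cons] by (simp add: comp_def)
qed

lemma word_val_in_Aut_T: "word_val w \<in> carrier Aut_T"
  using word_val_in_Gupta_Sidki subgroup.subset[OF subgroup_Gupta_Sidki] by blast

lemma inv_word_val: "inv\<^bsub>Aut_T\<^esub> (word_val w) = word_val (word_inv w)"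
  by (rule group.inv_equality[OF group_Aut_T _ word_val_in_Aut_T word_val_in_Aut_T])
    (simp add: word_val_inv' fun_eq_iff)

lemma word_val_inv_cong: "word_val u = word_val w \<Longrightarrow> word_val (word_inv u) = word_val (word_inv w)"
  by (metis inv_word_val)

lemma Gupta_Sidki_eq_range: "Gupta_Sidki = range word_val"
proof
  have "x \<in> range word_val" if "x \<in> generate Aut_T {gs_a, gs_b}" for x
    using that
  proof (induction rule: generate.induct)
    case one
    show ?case by (rule range_eqI[of _ _ "[]"]) simp
  next
    case (incl h)
    then show ?case
      by (auto simp: gs_a_eq_apow gs_b_eq_bpow intro: range_eqI[of _ _ "[La 1]"] range_eqI[of _ _ "[Lb 1]"])
  next
    case (inv h)
    then have "h = word_val [La 1] \<or> h = word_val [Lb 1]"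
      by (auto simp: gs_a_eq_apow gs_b_eq_bpow)
    then show ?case by (metis inv_word_val rangeI)
  next
    case (eng h1 h2)
    then obtain u w where "h1 = word_val u" "h2 = word_val w" by blast
    then have "h1 \<otimes>\<^bsub>Aut_T\<^esub> h2 = word_val (u @ w)" by simp
    then show ?case by (metis rangeI)
  qed
  then show "Gupta_Sidki \<subseteq> range word_val" unfolding Gupta_Sidki_def by blast
  show "range word_val \<subseteq> Gupta_Sidki" using word_val_in_Gupta_Sidki by blast
qed

section \<open>Subgroups of G and iterated sections\<close>

definition gs_subgroup :: "(vertex \<Rightarrow> vertex) set \<Rightarrow> bool" where
  "gs_subgroup K \<longleftrightarrow> subgroup K Aut_T \<and> K \<subseteq> Gupta_Sidki"

lemma gs_subgroupE:
  assumes "gs_subgroup K" "x \<in> K"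
  obtains w where "x = word_val w"
  using assms unfolding gs_subgroup_def Gupta_Sidki_eq_range by blast

lemma gs_subgroup_Nil: "gs_subgroup K \<Longrightarrow> word_val [] \<in> K"
  using subgroup.one_closed[of K Aut_T] by (simp add: gs_subgroup_def)

lemma gs_subgroup_append:
  "gs_subgroup K \<Longrightarrow> word_val u \<in> K \<Longrightarrow> word_val w \<in> K \<Longrightarrow> word_val (u @ w) \<in> K"
  using subgroup.m_closed[of K Aut_T "word_val u" "word_val w"] by (simp add: gs_subgroup_def)

lemma gs_subgroup_inv: "gs_subgroup K \<Longrightarrow> word_val w \<in> K \<Longrightarrow> word_val (word_inv w) \<in> K"
  using subgroup.m_inv_closed[of K Aut_T "word_val w"] by (simp add: gs_subgroup_def inv_word_val)

text \<open>Presents a subgroup as the values of a set of words closed under concatenation and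
  formal inversion. \<open>P\<close> may fail for other words representing the same elements;
  sections and loop labels are of this kind.\<close>

lemma gs_subgroupI:
  assumes "\<And>x. x \<in> K \<Longrightarrow> \<exists>w. P w \<and> x = word_val w"
    and "\<And>w. P w \<Longrightarrow> word_val w \<in> K"
    and "P []" and "\<And>u w. P u \<Longrightarrow> P w \<Longrightarrow> P (u @ w)" and "\<And>w. P w \<Longrightarrow> P (word_inv w)"
  shows "gs_subgroup K"
  unfolding gs_subgroup_def
proof
  show "K \<subseteq> Gupta_Sidki" using assms(1) word_val_in_Gupta_Sidki by blast
  show "subgroup K Aut_T"
  proof (rule group.subgroupI[OF group_Aut_T])
    show "K \<subseteq> carrier Aut_T" using assms(1) word_val_in_Aut_T by blast
    show "K \<noteq> {}" using assms(2,3) by blast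
  next
    fix x assume "x \<in> K"
    with assms(1) obtain w where "P w" "x = word_val w" by blast
    then show "inv\<^bsub>Aut_T\<^esub> x \<in> K" using assms(2,5) by (simp add: inv_word_val)
  next
    fix x y assume "x \<in> K" "y \<in> K"
    then obtain u w where "P u" "x = word_val u" "P w" "y = word_val w" using assms(1) by blast
    then show "x \<otimes>\<^bsub>Aut_T\<^esub> y \<in> K" using assms(2)[of "u @ w"] assms(4) by simp
  qed
qed

lemma vertex_section_singleton:
  assumes "gs_subgroup K"
  shows "vertex_section K [i] = {word_val (word_section w i) |w. word_val w \<in> K \<and> aexp w = 0}"
proof -
  have sec: "section_at (word_val w) [i] = word_val (word_section w i)" for w
    by (simp add: section_at_def word_val_Cons)
  have fix_iff: "word_val w [i] = [i] \<longleftrightarrow> aexp w = 0" for w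
    by (simp add: word_val_Cons)
  show ?thesis
    unfolding vertex_section_def
  proof (intro equalityI subsetI)
    fix y assume "y \<in> {section_at x [i] |x. x \<in> K \<and> x [i] = [i]}"
    then obtain x where x: "y = section_at x [i]" "x \<in> K" "x [i] = [i]" by blast
    then obtain w where "x = word_val w" using gs_subgroupE[OF assms] by blast
    with x show "y \<in> {word_val (word_section w i) |w. word_val w \<in> K \<and> aexp w = 0}"
      using sec fix_iff by blast
  next
    fix y assume "y \<in> {word_val (word_section w i) |w. word_val w \<in> K \<and> aexp w = 0}"
    then obtain w where "y = word_val (word_section w i)" "word_val w \<in> K" "aexp w = 0" by blast
    then show "y \<in> {section_at x [i] |x. x \<in> K \<and> x [i] = [i]}"
      using sec[symmetric] fix_iff by blast
  qed
qed

lemma vertex_sectionI: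
  assumes "gs_subgroup K" "word_val w \<in> K" "aexp w = 0" "u = word_section w i"
  shows "word_val u \<in> vertex_section K [i]"
  using assms by (auto simp: vertex_section_singleton)

lemma gs_subgroup_section_singleton:
  assumes K: "gs_subgroup K"
  shows "gs_subgroup (vertex_section K [i])"
proof (rule gs_subgroupI[where P = "\<lambda>u. \<exists>w. word_val w \<in> K \<and> aexp w = 0 \<and> u = word_section w i"])
  show "\<exists>w. word_val w \<in> K \<and> aexp w = 0 \<and> [] = word_section w i"
    using gs_subgroup_Nil[OF K] by (intro exI[of _ "[]"]) simp
next
  fix u1 u2
  assume "\<exists>w. word_val w \<in> K \<and> aexp w = 0 \<and> u1 = word_section w i"
    "\<exists>w. word_val w \<in> K \<and> aexp w = 0 \<and> u2 = word_section w i"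
  then obtain w1 w2 where w: "word_val w1 \<in> K" "aexp w1 = 0" "u1 = word_section w1 i"
    "word_val w2 \<in> K" "aexp w2 = 0" "u2 = word_section w2 i" by blast
  then show "\<exists>w. word_val w \<in> K \<and> aexp w = 0 \<and> u1 @ u2 = word_section w i"
    using gs_subgroup_append[OF K w(1,4)] by (intro exI[of _ "w1 @ w2"]) simp
next
  fix u
  assume "\<exists>w. word_val w \<in> K \<and> aexp w = 0 \<and> u = word_section w i"
  then obtain w where w: "word_val w \<in> K" "aexp w = 0" "u = word_section w i" by blast
  then show "\<exists>w. word_val w \<in> K \<and> aexp w = 0 \<and> word_inv u = word_section w i"
    using gs_subgroup_inv[OF K w(1)] word_section_inv[of w i] by (intro exI[of _ "word_inv w"]) simp
qed (use vertex_section_singleton[OF K] in auto)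

lemma vertex_section_Nil [simp]:
  assumes "gs_subgroup K"
  shows "vertex_section K [] = K"
proof -
  have "x [] = []" if "x \<in> K" for x
    using assms that subgroup.subset[of K Aut_T] by (auto simp: gs_subgroup_def)
  then show ?thesis by (auto simp: vertex_section_def section_at_def)
qed

text \<open>Automorphisms preserve prefixes and lengths, so fixing \<open>u @ v\<close> forces
  fixing \<open>u\<close>. Results on single letters thereby extend to all vertices.\<close>

lemma vertex_section_append:
  assumes "gs_subgroup K"
  shows "vertex_section (vertex_section K u) v = vertex_section K (u @ v)"
proof -
  have Aut: "x \<in> carrier Aut_T" if "x \<in> K" for x
    using that assms subgroup.subset unfolding gs_subgroup_def by blast
  have sec: "section_at (section_at x u) v = section_at x (u @ v)" for x
    by (simp add: section_at_def fun_eq_iff add.commute)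
  have fix_iff: "x (u @ v) = u @ v \<longleftrightarrow> x u = u \<and> section_at x u v = v" if "x \<in> K" for x
  proof
    have x: "x \<in> carrier Aut_T" using that by (rule Aut)
    assume *: "x (u @ v) = u @ v"
    obtain v' where "length v' = length v" "x (u @ v) = x u @ v'"
      using Aut_T_append[OF x] by blast
    with * have "x u = u" by (metis append_eq_append_conv)
    with * show "x u = u \<and> section_at x u v = v"
      by (simp add: section_at_def)
  next
    assume "x u = u \<and> section_at x u v = v"
    then show "x (u @ v) = u @ v" using section_at_spec[OF Aut[OF that]] by simp
  qed
  show ?thesis
    unfolding vertex_section_def
  proof (intro equalityI subsetI)
    fix y assume "y \<in> {section_at x v |x. x \<in> {section_at x u |x. x \<in> K \<and> x u = u} \<and> x v = v}"
    then obtain x where "y = section_at (section_at x u) v" "x \<in> K" "x u = u" "section_at x u v = v"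
      by blast
    then show "y \<in> {section_at x (u @ v) |x. x \<in> K \<and> x (u @ v) = u @ v}"
      using sec fix_iff by blast
  next
    fix y assume "y \<in> {section_at x (u @ v) |x. x \<in> K \<and> x (u @ v) = u @ v}"
    then obtain x where "y = section_at x (u @ v)" "x \<in> K" "x (u @ v) = u @ v"
      by blast
    then have "y = section_at (section_at x u) v" "x \<in> K" "x u = u" "section_at x u v = v"
      using sec fix_iff by metis+
    then show "y \<in> {section_at x v |x. x \<in> {section_at x u |x. x \<in> K \<and> x u = u} \<and> x v = v}"
      by blast
  qed
qed

lemma gs_subgroup_section: "gs_subgroup K \<Longrightarrow> gs_subgroup (vertex_section K v)"
proof (induction v rule: rev_induct)
  case (snoc i v)
  then show ?case
    using gs_subgroup_section_singleton[of "vertex_section K v" i]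
    by (simp add: vertex_section_append)
qed simp

lemma gs_subgroup_Gupta_Sidki: "gs_subgroup Gupta_Sidki"
  by (simp add: gs_subgroup_def subgroup_Gupta_Sidki)

lemma gs_subgroup_eq_Gupta_SidkiI:
  assumes K: "gs_subgroup K" and "word_val [La 1] \<in> K" "word_val [Lb 1] \<in> K"
  shows "K = Gupta_Sidki"
proof
  have "{gs_a, gs_b} \<subseteq> K" using assms(2,3) by (simp add: gs_a_eq_apow gs_b_eq_bpow)
  then show "Gupta_Sidki \<subseteq> K"
    unfolding Gupta_Sidki_def
    using group.generate_subgroup_incl[OF group_Aut_T, of "{gs_a, gs_b}" K] K
    by (simp add: gs_subgroup_def)
qed (use K in \<open>simp add: gs_subgroup_def\<close>)

lemma infinite_Gupta_Sidki: "infinite Gupta_Sidki"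
proof
  assume fin: "finite Gupta_Sidki"
  let ?S = "{x \<in> Gupta_Sidki. x [0] = [0]}"
  have "vertex_section Gupta_Sidki [0] = Gupta_Sidki"
  proof (rule gs_subgroup_eq_Gupta_SidkiI)
    show "gs_subgroup (vertex_section Gupta_Sidki [0])"
      by (rule gs_subgroup_section[OF gs_subgroup_Gupta_Sidki])
    have "word_val (word_section [Lb 1] 0) \<in> vertex_section Gupta_Sidki [0]"
      by (rule vertex_sectionI[OF gs_subgroup_Gupta_Sidki word_val_in_Gupta_Sidki _ refl]) simp
    then show "word_val [La 1] \<in> vertex_section Gupta_Sidki [0]" by simp
    \<comment> \<open>The first letter of this word takes 0 to 2, where \<open>b\<close> has section
      \<open>b\<close>, and the last takes 2 back to 0.\<close>
    have "word_val (word_section [La 2, Lb 1, La 1] 0) \<in> vertex_section Gupta_Sidki [0]"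
      by (rule vertex_sectionI[OF gs_subgroup_Gupta_Sidki word_val_in_Gupta_Sidki _ refl]) simp
    then show "word_val [Lb 1] \<in> vertex_section Gupta_Sidki [0]" by (simp add: o_def)
  qed
  then have "Gupta_Sidki = (\<lambda>x. section_at x [0]) ` ?S"
    unfolding vertex_section_def by blast
  then have "card Gupta_Sidki = card ((\<lambda>x. section_at x [0]) ` ?S)"
    by (rule arg_cong)
  also have "\<dots> \<le> card ?S"
    by (rule card_image_le) (use fin in simp)
  also have "\<dots> < card Gupta_Sidki"
  proof (rule psubset_card_mono[OF fin], rule psubsetI)
    have "word_val [La 1] [0] \<noteq> [0]" by (simp add: word_val_Cons)
    then show "?S \<noteq> Gupta_Sidki" using word_val_in_Gupta_Sidki[of "[La 1]"] by blast
  qed blast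
  finally show False by simp
qed

subsection \<open>Subgroups mapping onto the abelianization\<close>

text \<open>For a subgroup of G this is transitivity on level 1 alone, where G acts by translations
  of Z/3.\<close>

definition level_transitive :: "(vertex \<Rightarrow> vertex) set \<Rightarrow> bool" where
  "level_transitive K \<longleftrightarrow> (\<exists>w. word_val w \<in> K \<and> aexp w = 1)"

text \<open>The pairs (\<open>aexp\<close>, \<open>bexp\<close>) describe the abelianization
  (Z/3)^2, which is generated by any (1, x) together with any (0, y), y nonzero. \<open>bexp\<close>
  is read off a representing word, so that its invariance does not have to be established.\<close>

definition ab_surjective :: "(vertex \<Rightarrow> vertex) set \<Rightarrow> bool" where
  "ab_surjective K \<longleftrightarrow>
     level_transitive K \<and> (\<exists>w. word_val w \<in> K \<and> aexp w = 0 \<and> bexp w \<noteq> 0)"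

lemma level_transitiveI:
  assumes K: "gs_subgroup K" and w: "word_val w \<in> K" "aexp w \<noteq> 0"
  shows "level_transitive K"
proof -
  have "aexp w = 1 \<or> aexp (w @ w) = 1"
    using three_cases[of "aexp w"] w(2) by (elim disjE) simp_all
  then show ?thesis
    unfolding level_transitive_def using w(1) gs_subgroup_append[OF K w(1) w(1)] by blast
qed

lemma level_transitiveE:
  assumes K: "gs_subgroup K" and "level_transitive K"
  obtains x where "word_val x \<in> K" "aexp x = k"
proof -
  obtain w where w: "word_val w \<in> K" "aexp w = 1"
    using assms(2) unfolding level_transitive_def by blast
  have "aexp [] = k \<or> aexp w = k \<or> aexp (w @ w) = k"
    using three_cases[of k] w(2) by (elim disjE) simp_all
  then show ?thesis
    using that w(1) gs_subgroup_append[OF K w(1) w(1)] gs_subgroup_Nil[OF K] by blast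
qed

text \<open>Conjugation by \<open>x\<close> carries the stabilizer of \<open>[j]\<close> to that of
  \<open>[i]\<close>. On sections it becomes conjugation by the section of \<open>x\<close> at
  \<open>i\<close>, which may lie outside the section of \<open>K\<close>.\<close>

lemma conj_vertex_section:
  assumes K: "gs_subgroup K" and x: "word_val x \<in> K" "i + aexp x = j"
    and y: "word_val y \<in> vertex_section K [j]"
  shows "word_val (word_section x i @ y @ word_inv (word_section x i)) \<in> vertex_section K [i]"
proof -
  obtain w where w: "word_val w \<in> K" "aexp w = 0" "word_val y = word_val (word_section w j)"
    using y vertex_section_singleton[OF K] by auto
  have "word_val (x @ w @ word_inv x) \<in> K"
    using gs_subgroup_append[OF K x(1) gs_subgroup_append[OF K w(1) gs_subgroup_inv[OF K x(1)]]] .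
  then have "word_val (word_section (x @ w @ word_inv x) i) \<in> vertex_section K [i]"
    using w(2) by (intro vertex_sectionI[OF K _ _ refl]) simp_all
  also have "word_section (x @ w @ word_inv x) i
      = word_section x i @ word_section w j @ word_inv (word_section x i)"
    using w(2) x(2) word_section_inv[of x i] by simp
  finally show ?thesis using w(3) by (simp add: comp_def)
qed

text \<open>Transitivity makes the sections at two letters conjugate, and conjugation of words
  preserves both exponent sums.\<close>

lemma vertex_section_transport:
  assumes K: "gs_subgroup K" and "level_transitive K" and "word_val y \<in> vertex_section K [j]"
  obtains y' where "word_val y' \<in> vertex_section K [i]" "aexp y' = aexp y" "bexp y' = bexp y"
proof -
  obtain x where "word_val x \<in> K" "aexp x = j - i" using level_transitiveE[OF assms(1,2)] .
  then show ?thesis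
    using conj_vertex_section[OF K _ _ assms(3), of x i]
    by (intro that[of "word_section x i @ y @ word_inv (word_section x i)"]) simp_all
qed

text \<open>The cube of \<open>x\<close> fixes level 1, and its section at \<open>i\<close> is the
  product of the sections of \<open>x\<close> along the whole orbit of \<open>i\<close>. The
  conservation laws then give its length and exponents.\<close>

lemma vertex_section_cube:
  assumes K: "gs_subgroup K" and x: "word_val x \<in> K" "aexp x \<noteq> 0"
  obtains y where "word_val y \<in> vertex_section K [i]" "aexp y = 0" "bexp y = bexp x" "blen y = blen x"
proof
  let ?k = "aexp x"
  let ?y = "word_section x i @ word_section x (i + ?k) @ word_section x (i + (?k + ?k))"
  have "word_val (x @ x @ x) \<in> K"
    using gs_subgroup_append[OF K x(1) gs_subgroup_append[OF K x(1) x(1)]] .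
  then show "word_val ?y \<in> vertex_section K [i]"
    using three_times[of ?k] by (intro vertex_sectionI[OF K, of "x @ x @ x"]) (simp_all add: add.assoc)
  show "aexp ?y = 0"
    using sum_three_orbit[OF x(2), of "\<lambda>j. aexp (word_section x j)" i] sum_aexp_section[of x] by simp
  show "bexp ?y = bexp x"
    using sum_three_orbit[OF x(2), of "\<lambda>j. bexp (word_section x j)" i] sum_bexp_section[of x] by simp
  show "blen ?y = blen x"
    using sum_three_orbit[OF x(2), of "\<lambda>j. blen (word_section x j)" i] sum_blen_section[of x] by simp
qed

text \<open>Transitivity comes from \<open>y\<close>: if all its sections had \<open>aexp\<close> 0,
  their three \<open>bexp\<close> values would coincide and add up to 0. The second condition comes
  from cubing an element with both exponent sums nonzero.\<close>

lemma ab_surjective_section_singleton: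
  assumes K: "gs_subgroup K" and ab: "ab_surjective K"
  shows "ab_surjective (vertex_section K [i])"
proof -
  have tr: "level_transitive K" using ab unfolding ab_surjective_def by blast
  obtain y where y: "word_val y \<in> K" "aexp y = 0" "bexp y \<noteq> 0"
    using ab unfolding ab_surjective_def by blast
  obtain x where x: "word_val x \<in> K" "aexp x = 1"
    using tr unfolding level_transitive_def by blast
  have Ki: "gs_subgroup (vertex_section K [i])" by (rule gs_subgroup_section[OF K])
  have "\<exists>j. aexp (word_section y j) \<noteq> 0"
  proof (rule ccontr)
    assume "\<not> ?thesis"
    then have 0: "aexp (word_section y j) = 0" for j by blast
    have "bexp (word_section y 2) = bexp (word_section y 1)"
      using 0[of 0] by (simp add: aexp_section)
    moreover have "bexp (word_section y 0) = bexp (word_section y 2)"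
      using 0[of 1] by (simp add: aexp_section three_eq_zero)
    ultimately have "bexp y = 0"
      using sum_bexp_section[of y] three_times by (simp add: sum_three)
    with y(3) show False by blast
  qed
  then obtain j where j: "aexp (word_section y j) \<noteq> 0" by blast
  have "word_val (word_section y j) \<in> vertex_section K [j]"
    using vertex_sectionI[OF K y(1,2) refl] .
  then obtain y' where "word_val y' \<in> vertex_section K [i]" "aexp y' = aexp (word_section y j)"
    using vertex_section_transport[OF K tr, of _ j i] by blast
  then have tri: "level_transitive (vertex_section K [i])"
    using level_transitiveI[OF Ki] j by simp
  \<comment> \<open>One of \<open>x\<close> and \<open>x @ y\<close> has both exponent sums
    nonzero.\<close>
  obtain x' where x': "word_val x' \<in> K" "aexp x' \<noteq> 0" "bexp x' \<noteq> 0"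
  proof (cases "bexp x = 0")
    case True
    then show ?thesis
      using that[of "x @ y"] gs_subgroup_append[OF K x(1) y(1)] x(2) y(2,3) by simp
  qed (use that x in simp)
  obtain z where "word_val z \<in> vertex_section K [i]" "aexp z = 0" "bexp z = bexp x'"
    using vertex_section_cube[OF K x'(1,2)] by blast
  with tri x'(3) show ?thesis unfolding ab_surjective_def by auto
qed

lemma ab_surjective_section:
  assumes "gs_subgroup K" "ab_surjective K"
  shows "ab_surjective (vertex_section K v)"
proof (induction v rule: rev_induct)
  case (snoc i v)
  then show ?case
    using ab_surjective_section_singleton[OF gs_subgroup_section[OF assms(1)]]
    by (simp add: vertex_section_append[OF assms(1)])
qed (simp add: assms)

section \<open>Finding the generators in a section\<close>

lemma gs_subgroup_bpow:
  assumes K: "gs_subgroup K" and e: "word_val [Lb e] \<in> K" "e \<noteq> 0"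
  shows "word_val [Lb k] \<in> K"
proof -
  have two: "word_val [Lb e, Lb e] \<in> K" using gs_subgroup_append[OF K e(1) e(1)] by simp
  have "word_val [Lb e, Lb e] = word_val [Lb (e + e)]" "word_val [] = word_val [Lb 0]"
    by (auto simp: bpow_add)
  moreover have "k = 0 \<or> k = e \<or> k = e + e"
    using three_cases[of k] three_cases[of e] e(2) by (elim disjE) simp_all
  ultimately show ?thesis using e(1) two gs_subgroup_Nil[OF K] by metis
qed

text \<open>Induction on the length of \<open>y\<close>. A section of full length is a nontrivial
  power of \<open>b\<close>. Otherwise all sections are shorter, and one has nonzero
  \<open>bexp\<close> since these values add up to \<open>bexp y\<close>. If its \<open>aexp\<close>
  is nonzero, its cube, one level lower, restores \<open>aexp = 0\<close> at the same
  length.\<close>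

lemma exists_section_containing_b:
  assumes "gs_subgroup K" "word_val y \<in> K" "aexp y = 0" "bexp y \<noteq> 0"
  shows "\<exists>v. word_val [Lb 1] \<in> vertex_section K v"
  using assms
proof (induction "blen y" arbitrary: K y rule: less_induct)
  case less
  note K = less.prems(1)
  have sec: "word_val (word_section y i) \<in> vertex_section K [i]" for i
    using vertex_sectionI[OF K less.prems(2,3) refl] .
  have Ki: "gs_subgroup (vertex_section K [i])" for i by (rule gs_subgroup_section[OF K])
  show ?case
  proof (cases "\<exists>i. blen (word_section y i) = blen y")
    case True
    then obtain i where "blen (word_section y i) = blen y" by blast
    then have "word_val (word_section y i) = word_val [Lb (bexp y)]"
      using word_val_section_if_blen_eq by auto
    then have "word_val [Lb 1] \<in> vertex_section K [i]"
      using gs_subgroup_bpow[OF Ki _ less.prems(4)] sec[of i] by metis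
    then show ?thesis by blast
  next
    case False
    then have short: "blen (word_section y i) < blen y" for i
      using blen_section_le[of y i] by (meson le_neq_implies_less)
    obtain i where i: "bexp (word_section y i) \<noteq> 0"
      using sum_bexp_section[of y] less.prems(4) by (metis sum.neutral)
    show ?thesis
    proof (cases "aexp (word_section y i) = 0")
      case True
      then show ?thesis
        using less.hyps[OF short Ki sec _ i] vertex_section_append[OF K] by metis
    next
      case False
      obtain z where "word_val z \<in> vertex_section (vertex_section K [i]) [0]" "aexp z = 0"
        "bexp z = bexp (word_section y i)" "blen z = blen (word_section y i)"
        using vertex_section_cube[OF Ki sec False] .
      then have "\<exists>v. word_val [Lb 1] \<in> vertex_section (vertex_section (vertex_section K [i]) [0]) v"
        using less.hyps[of z] short[of i] i gs_subgroup_section[OF Ki] by simp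
      then show ?thesis using vertex_section_append[OF K] by metis
    qed
  qed
qed

text \<open>The given conjugate of \<open>a\<close> and its inverse move 2 to 0 and to 1, where
  \<open>b\<close> has sections \<open>a\<close> and \<open>a^-1\<close>. Conjugating
  \<open>b\<close> by them puts two new conjugates of \<open>a\<close> into the section at 2, which
  still contains \<open>b\<close>. Each new conjugator uses only two of the three sections of the
  old one, so induction on \<open>blen g\<close> applies unless all letters \<open>b\<close> sit in
  the section at 2.\<close>

lemma exists_section_eq_if_conj:
  assumes "gs_subgroup K" "word_val [Lb 1] \<in> K" "word_val (g @ [La 1] @ word_inv g) \<in> K"
  shows "\<exists>v. vertex_section K v = Gupta_Sidki"
  using assms
proof (induction "blen g" arbitrary: K g rule: less_induct)
  case less
  note K = less.prems(1)
  \<comment> \<open>Powers of \<open>a\<close> commute with \<open>a\<close>, so the correction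
    keeps the conjugate and makes the conjugator fix level 1.\<close>
  define f where "f = g @ [La (- aexp g)]"
  have f: "aexp f = 0" "blen f = blen g"
    by (simp_all add: f_def)
  have "word_val (f @ [La 1] @ word_inv f) = word_val (g @ [La 1] @ word_inv g)"
    by (auto simp: f_def apow_add)
  with less.prems(3) have fK: "word_val (f @ [La 1] @ word_inv f) \<in> K" by simp
  have f'K: "word_val (f @ [La (- 1)] @ word_inv f) \<in> K"
    using gs_subgroup_inv[OF K fK] by simp
  let ?K2 = "vertex_section K [2]"
  have K2: "gs_subgroup ?K2" by (rule gs_subgroup_section[OF K])
  have b_sec: "word_val (word_section [Lb 1] i) \<in> vertex_section K [i]" for i
    by (rule vertex_sectionI[OF K less.prems(2) _ refl]) simp
  have b2: "word_val [Lb 1] \<in> ?K2" using b_sec[of 2] by simp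
  \<comment> \<open>\<open>h 0\<close> and \<open>h 1\<close> are the sections at 2 of
    \<open>f a f^-1\<close> and \<open>f a^-1 f^-1\<close>; the middle \<open>La 0\<close> is the
    section of \<open>a\<close> or its inverse.\<close>
  define h where "h i = word_section f 2 @ [La 0] @ word_inv (word_section f i)" for i
  have blen_h: "blen (h i) = blen (word_section f 2) + blen (word_section f i)" for i
    by (simp add: h_def)
  have inv_sec: "word_section (word_inv f) i = word_inv (word_section f i)" for i
    using word_section_inv[of f i] f(1) by simp
  have "word_section (f @ [La 1] @ word_inv f) 2 = h 0"
    using f(1) by (simp add: h_def inv_sec three_eq_zero)
  then have h0: "word_val (h 0 @ [La 1] @ word_inv (h 0)) \<in> ?K2"
    using conj_vertex_section[OF K fK, of 2 0 "[La 1]"] b_sec[of 0] f(1) by simp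
  have "word_section (f @ [La (- 1)] @ word_inv f) 2 = h 1"
    using f(1) by (simp add: h_def inv_sec)
  then have "word_val (h 1 @ [La (- 1)] @ word_inv (h 1)) \<in> ?K2"
    using conj_vertex_section[OF K f'K, of 2 1 "[La (- 1)]"] b_sec[of 1] f(1) by simp
  then have h1: "word_val (h 1 @ [La 1] @ word_inv (h 1)) \<in> ?K2"
    using gs_subgroup_inv[OF K2, of "h 1 @ [La (- 1)] @ word_inv (h 1)"] by simp
  have sum: "blen (word_section f 0) + blen (word_section f 1) + blen (word_section f 2) = blen g"
    using sum_blen_section[of f] f(2) by (simp add: sum_three)
  \<comment> \<open>\<open>h 0\<close> omits the section of \<open>f\<close> at 1 and
    \<open>h 1\<close> the one at 0, so a letter \<open>b\<close> there makes it shorter than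
    \<open>g\<close>. The last case covers \<open>blen g = 0\<close>.\<close>
  consider "blen (word_section f 1) > 0" | "blen (word_section f 0) > 0"
    | "blen (word_section f 0) = 0" "blen (word_section f 2) = blen f"
    using sum f(2) by linarith
  then show ?case
  proof cases
    case 1
    then have "\<exists>v. vertex_section ?K2 v = Gupta_Sidki"
      using sum by (intro less.hyps[OF _ K2 b2 h0]) (simp add: blen_h)
    then show ?thesis using vertex_section_append[OF K] by metis
  next
    case 2
    then have "\<exists>v. vertex_section ?K2 v = Gupta_Sidki"
      using sum by (intro less.hyps[OF _ K2 b2 h1]) (simp add: blen_h)
    then show ?thesis using vertex_section_append[OF K] by metis
  next
    case 3
    have bK: "word_val [Lb k] \<in> ?K2" for k
      by (rule gs_subgroup_bpow[OF K2 b2]) simp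
    \<comment> \<open>Here \<open>h 0\<close> is \<open>b^e a^c\<close>, so the conjugate is
      \<open>b^e a b^-e\<close>, and conjugating by the available power of \<open>b\<close> recovers
      \<open>a\<close>.\<close>
    define e c where "e = bexp f" and "c = - aexp (word_section f 0)"
    have "word_val (word_inv (word_section f 0)) = apow c"
      using 3(1) by (subst word_val_if_blen_zero) (simp_all add: c_def)
    moreover have "word_val (word_section f 2) = bpow e"
      using word_val_section_if_blen_eq[OF 3(2)] by (simp add: e_def)
    ultimately have "word_val (h 0) = word_val [Lb e, La c]"
      by (auto simp: h_def)
    with word_val_inv_cong[OF this]
    have "word_val ([Lb (- e)] @ (h 0 @ [La 1] @ word_inv (h 0)) @ [Lb e]) = word_val [La 1]"
      by (auto simp: apow_add bpow_add)
    moreover have "word_val ([Lb (- e)] @ (h 0 @ [La 1] @ word_inv (h 0)) @ [Lb e]) \<in> ?K2"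
      using gs_subgroup_append[OF K2 bK[of "- e"] gs_subgroup_append[OF K2 h0 bK[of e]]] .
    ultimately have "?K2 = Gupta_Sidki"
      using gs_subgroup_eq_Gupta_SidkiI[OF K2 _ b2] by simp
    then show ?thesis by blast
  qed
qed

lemma exists_section_eq_if_ab_surjective:
  assumes K: "gs_subgroup K" and ab: "ab_surjective K"
  shows "\<exists>v. vertex_section K v = Gupta_Sidki"
proof -
  obtain y where y: "word_val y \<in> K" "aexp y = 0" "bexp y \<noteq> 0"
    using ab unfolding ab_surjective_def by blast
  obtain v where b: "word_val [Lb 1] \<in> vertex_section K v"
    using exists_section_containing_b[OF K y] by blast
  let ?L = "vertex_section K v"
  have L: "gs_subgroup ?L" by (rule gs_subgroup_section[OF K])
  have b_sec: "word_val (word_section [Lb 1] i) \<in> vertex_section ?L [i]" for i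
    by (rule vertex_sectionI[OF L b _ refl]) simp
  obtain x where x: "word_val x \<in> ?L" "aexp x = 1"
    using ab_surjective_section[OF K ab] unfolding ab_surjective_def level_transitive_def by blast
  \<comment> \<open>\<open>x\<close> takes 2 to 0, where \<open>b\<close> has section
    \<open>a\<close>; at 2 the section of \<open>b\<close> is \<open>b\<close>.\<close>
  have "word_val (word_section x 2 @ [La 1] @ word_inv (word_section x 2)) \<in> vertex_section ?L [2]"
    using b_sec[of 0] x(2) by (intro conj_vertex_section[OF L x(1)]) simp_all
  then have "\<exists>u. vertex_section (vertex_section ?L [2]) u = Gupta_Sidki"
    using b_sec[of 2] by (intro exists_section_eq_if_conj[OF gs_subgroup_section[OF L]]) simp_all
  then show ?thesis
    using vertex_section_append[OF K] by (metis vertex_section_append[OF L])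
qed

text \<open>If \<open>K\<close> is transitive but not \<open>ab_surjective\<close>, then
  \<open>aexp w = 0\<close> forces \<open>bexp w = 0\<close>. For a \<open>w\<close> whose section
  at \<open>i\<close> has \<open>aexp\<close> 1, this makes the \<open>bexp\<close> values of its
  sections an arithmetic progression. Two sections, moved to \<open>i\<close>, then have a quotient
  with \<open>aexp\<close> 0 and nonzero \<open>bexp\<close>.\<close>

lemma exists_section_ab_surjective:
  assumes K: "gs_subgroup K" and tr: "level_transitive K" "level_transitive (vertex_section K [i])"
  shows "\<exists>v. ab_surjective (vertex_section K v)"
proof (cases "ab_surjective K")
  case True
  then have "ab_surjective (vertex_section K [])" using K by simp
  then show ?thesis by blast
next
  case False
  let ?Ki = "vertex_section K [i]"
  have Ki: "gs_subgroup ?Ki" by (rule gs_subgroup_section[OF K])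
  obtain u where u: "word_val u \<in> ?Ki" "aexp u = 1"
    using tr(2) unfolding level_transitive_def by blast
  then obtain w where w: "word_val w \<in> K" "aexp w = 0" "word_val u = word_val (word_section w i)"
    using vertex_section_singleton[OF K] by auto
  define m where "m j = bexp (word_section w j)" for j
  have aexp_m: "aexp (word_section w j) = m (j + 2) - m (j + 1)" for j
    by (simp add: aexp_section m_def)
  have "m i + (m (i + 1) + m (i + 2)) = bexp w"
    using sum_three_orbit[of 1 m i] sum_bexp_section[of w] by (simp add: m_def)
  then have sum0: "m i + (m (i + 1) + m (i + 2)) = 0"
    using False tr(1) w(1,2) unfolding ab_surjective_def by auto
  have d: "m (i + 2) - m (i + 1) = 1"
    using aexp_eq_if_word_val_eq[OF w(3)] u(2) aexp_m[of i] by simp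
  \<comment> \<open>The three values add up to 0 and one cyclic difference is 1, hence all are 1,
    and every section of \<open>w\<close> has \<open>aexp\<close> 1.\<close>
  have "m i - m (i + 2) = 1" "m (i + 1) - m i = 1"
    using sum0 d three_cases[of "m i"] three_cases[of "m (i + 1)"] three_cases[of "m (i + 2)"]
    by (elim disjE; simp)+
  then have a1: "aexp (word_section w (i + 1)) = 1" and a2: "aexp (word_section w (i + 2)) = 1"
    using aexp_m[of "i + 1"] aexp_m[of "i + 2"] by (simp_all add: add.assoc four_three three_eq_zero)
  have sec: "word_val (word_section w j) \<in> vertex_section K [j]" for j
    using vertex_sectionI[OF K w(1,2) refl] .
  obtain u1 where u1: "word_val u1 \<in> ?Ki" "aexp u1 = 1" "bexp u1 = m (i + 1)"
    using vertex_section_transport[OF K tr(1) sec[of "i + 1"], of i] a1 m_def by metis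
  obtain u2 where u2: "word_val u2 \<in> ?Ki" "aexp u2 = 1" "bexp u2 = m (i + 2)"
    using vertex_section_transport[OF K tr(1) sec[of "i + 2"], of i] a2 m_def by metis
  have "word_val (u2 @ word_inv u1) \<in> ?Ki"
    by (rule gs_subgroup_append[OF Ki u2(1) gs_subgroup_inv[OF Ki u1(1)]])
  moreover have "aexp (u2 @ word_inv u1) = 0" "bexp (u2 @ word_inv u1) \<noteq> 0"
    using u1 u2 d by simp_all
  ultimately have "ab_surjective ?Ki"
    using tr(2) unfolding ab_surjective_def by blast
  then show ?thesis by blast
qed

subsection \<open>Labelled Schreier graphs\<close>

text \<open>Graph vertices are named by tree vertices so that a lift can append a letter. An edge
  \<open>(u, w, v)\<close> need not satisfy \<open>word_val w u = v\<close>; its label is meant as a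
  section acting below \<open>u\<close>.\<close>

type_synonym gs_graph = "(vertex \<times> gs_word \<times> vertex) set"

inductive walk :: "gs_graph \<Rightarrow> vertex \<Rightarrow> gs_word \<Rightarrow> vertex \<Rightarrow> bool" for E where
  walk_Nil: "walk E u [] u"
| walk_forward: "(u, w, v) \<in> E \<Longrightarrow> walk E v w' x \<Longrightarrow> walk E u (w @ w') x"
| walk_backward: "(v, w, u) \<in> E \<Longrightarrow> walk E v w' x \<Longrightarrow> walk E u (word_inv w @ w') x"

lemma walk_append: "walk E u w v \<Longrightarrow> walk E v w' x \<Longrightarrow> walk E u (w @ w') x"
proof (induction rule: walk.induct)
  case (walk_forward u w v w1 x1)
  then show ?case using walk.walk_forward[of u w v E "w1 @ w'" x] by simp
next
  case (walk_backward v w u w1 x1)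
  then show ?case using walk.walk_backward[of v w u E "w1 @ w'" x] by simp
qed simp

lemma walk_edge: "(u, w, v) \<in> E \<Longrightarrow> walk E u w v"
  using walk_forward[OF _ walk_Nil] by fastforce

lemma walk_inv: "walk E u w v \<Longrightarrow> walk E v (word_inv w) u"
proof (induction rule: walk.induct)
  case (walk_Nil u)
  show ?case by (simp add: walk.walk_Nil)
next
  case (walk_forward u w v w' x)
  have "walk E v (word_inv w @ []) u"
    using walk_forward.hyps(1) walk.walk_Nil by (rule walk.walk_backward)
  with walk_forward.IH show ?case using walk_append by fastforce
next
  case (walk_backward v w u w' x)
  with walk_append[OF walk_backward.IH walk_edge[OF walk_backward.hyps(1)]]
  show ?case by simp
qed

definition holonomy :: "gs_graph \<Rightarrow> vertex \<Rightarrow> (vertex \<Rightarrow> vertex) set" where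
  "holonomy E u = {word_val w |w. walk E u w u}"

lemma gs_subgroup_holonomy: "gs_subgroup (holonomy E u)"
  by (rule gs_subgroupI[where P = "\<lambda>w. walk E u w u"])
    (auto simp: holonomy_def intro: walk_Nil walk_append walk_inv)

definition lift_edge :: "(vertex \<times> gs_word \<times> vertex) \<times> 3 \<Rightarrow> vertex \<times> gs_word \<times> vertex" where
  "lift_edge = (\<lambda>((u, w, v), i). (u @ [i], word_section w i, v @ [i + aexp w]))"

text \<open>Iterated from loops at the root, this yields the Schreier graphs of the successive
  levels, labelled by sections of the generators.\<close>

definition lift_graph :: "gs_graph \<Rightarrow> gs_graph" where
  "lift_graph E = lift_edge ` (E \<times> UNIV)"

lemma lift_graph_iff:
  "e \<in> lift_graph E \<longleftrightarrow>
     (\<exists>u w v i. (u, w, v) \<in> E \<and> e = (u @ [i], word_section w i, v @ [i + aexp w]))"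
  by (force simp: lift_graph_def lift_edge_def)

lemma walk_lift:
  "walk E u w v \<Longrightarrow> walk (lift_graph E) (u @ [i]) (word_section w i) (v @ [i + aexp w])"
proof (induction arbitrary: i rule: walk.induct)
  case (walk_Nil u)
  show ?case by (simp add: walk.walk_Nil)
next
  case (walk_forward u w v w' x)
  have "(u @ [i], word_section w i, v @ [i + aexp w]) \<in> lift_graph E"
    using walk_forward.hyps(1) lift_graph_iff by blast
  from walk.walk_forward[OF this walk_forward.IH] show ?case
    by (simp add: add.assoc)
next
  case (walk_backward v w u w' x)
  \<comment> \<open>The reversed edge ends at \<open>u @ [i]\<close>, so its lift starts at the
    letter \<open>i - aexp w\<close>.\<close>
  define j where "j = i - aexp w"
  have i: "i = j + aexp w" by (simp add: j_def)
  have "(v @ [j], word_section w j, u @ [i]) \<in> lift_graph E"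
    using walk_backward.hyps(1) lift_graph_iff i by blast
  from walk.walk_backward[OF this walk_backward.IH] show ?case
    by (simp add: i word_section_inv)
qed

lemma walk_unlift:
  assumes "walk (lift_graph E) p w' q" "p = u @ [i]"
  shows "\<exists>w v. q = v @ [i + aexp w] \<and> w' = word_section w i \<and> walk E u w v"
  using assms
proof (induction arbitrary: u i rule: walk.induct)
  case (walk_Nil p)
  then show ?case by (intro exI[of _ "[]"] exI[of _ u]) (simp add: walk.walk_Nil)
next
  case (walk_forward p w1 p' w2 q)
  obtain w v where e: "(u, w, v) \<in> E" "w1 = word_section w i" "p' = v @ [i + aexp w]"
    using walk_forward.hyps(1) walk_forward.prems by (auto simp: lift_graph_iff)
  obtain w' v' where "q = v' @ [i + aexp w + aexp w']" "w2 = word_section w' (i + aexp w)" "walk E v w' v'"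
    using walk_forward.IH[OF e(3)] by blast
  then show ?case
    using walk.walk_forward[OF e(1)] e(2) by (intro exI[of _ "w @ w'"] exI[of _ v']) (simp add: add.assoc)
next
  case (walk_backward p' w1 p w2 q)
  obtain w v j where e: "(v, w, u) \<in> E" "w1 = word_section w j" "p' = v @ [j]" "i = j + aexp w"
    using walk_backward.hyps(1) walk_backward.prems by (auto simp: lift_graph_iff)
  obtain w' v' where "q = v' @ [j + aexp w']" "w2 = word_section w' j" "walk E v w' v'"
    using walk_backward.IH[OF e(3)] by blast
  then show ?case
    using walk.walk_backward[OF e(1)] e(2,4)
    by (intro exI[of _ "word_inv w @ w'"] exI[of _ v']) (simp add: word_section_inv)
qed

text \<open>Loops at \<open>u @ [i]\<close> are exactly the lifts of the loops at \<open>u\<close>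
  whose label fixes level 1.\<close>

lemma holonomy_lift: "holonomy (lift_graph E) (u @ [i]) = vertex_section (holonomy E u) [i]"
proof (intro equalityI subsetI)
  fix x assume "x \<in> holonomy (lift_graph E) (u @ [i])"
  then obtain w' where w': "x = word_val w'" "walk (lift_graph E) (u @ [i]) w' (u @ [i])"
    unfolding holonomy_def by blast
  then obtain w where w: "aexp w = 0" "w' = word_section w i" "walk E u w u"
    using walk_unlift[OF w'(2) refl] by auto
  then have "word_val w \<in> holonomy E u" unfolding holonomy_def by blast
  then show "x \<in> vertex_section (holonomy E u) [i]"
    using vertex_sectionI[OF gs_subgroup_holonomy _ w(1,2)] w'(1) by simp
next
  fix x assume "x \<in> vertex_section (holonomy E u) [i]"
  then obtain w where w: "x = word_val (word_section w i)" "word_val w \<in> holonomy E u" "aexp w = 0"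
    using vertex_section_singleton[OF gs_subgroup_holonomy] by auto
  then obtain w0 where w0: "word_val w = word_val w0" "walk E u w0 u"
    unfolding holonomy_def by blast
  have "aexp w0 = 0" using aexp_eq_if_word_val_eq[OF w0(1)] w(3) by simp
  then have "walk (lift_graph E) (u @ [i]) (word_section w0 i) (u @ [i])"
    using walk_lift[OF w0(2), of i] by simp
  then show "x \<in> holonomy (lift_graph E) (u @ [i])"
    unfolding holonomy_def using w(1) word_val_section_cong[OF w0(1)] by blast
qed

section \<open>Weights of components\<close>

definition reachable :: "gs_graph \<Rightarrow> vertex \<Rightarrow> vertex \<Rightarrow> bool" where
  "reachable E u x \<longleftrightarrow> (\<exists>w. walk E u w x)"

definition edge_weight :: "vertex \<times> gs_word \<times> vertex \<Rightarrow> nat" where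
  "edge_weight e = blen (fst (snd e))"

definition component_weight :: "gs_graph \<Rightarrow> vertex \<Rightarrow> nat" where
  "component_weight E u = (\<Sum>e \<in> {e \<in> E. reachable E u (fst e)}. edge_weight e)"

lemma reachable_liftE:
  assumes "reachable (lift_graph E) (u @ [i]) (x @ [j])"
  obtains w where "walk E u w x" "j = i + aexp w"
proof -
  obtain w' where "walk (lift_graph E) (u @ [i]) w' (x @ [j])"
    using assms unfolding reachable_def by blast
  from walk_unlift[OF this refl] show ?thesis using that by auto
qed

lemma reachable_unlift: "reachable (lift_graph E) (u @ [i]) (x @ [j]) \<Longrightarrow> reachable E u x"
  unfolding reachable_def[of E] by (blast elim: reachable_liftE)

lemma sum_edge_weight_lift: "(\<Sum>j\<in>UNIV. edge_weight (lift_edge (e, j))) = edge_weight e"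
  by (cases e) (simp add: lift_edge_def edge_weight_def sum_blen_section)

text \<open>The component of \<open>u @ [i]\<close> lies above that of \<open>u\<close>. Edges with
  different labels may have the same lift, so grouping by the edge below gives only an
  inequality.\<close>

lemma component_weight_lift_le_sum:
  assumes "finite E"
  shows "component_weight (lift_graph E) (u @ [i]) \<le>
    (\<Sum>e \<in> {e \<in> E. reachable E u (fst e)}.
       \<Sum>j \<in> {j. reachable (lift_graph E) (u @ [i]) (fst e @ [j])}. edge_weight (lift_edge (e, j)))"
proof -
  let ?R = "\<lambda>e. {j. reachable (lift_graph E) (u @ [i]) (fst e @ [j])}"
  let ?I = "Sigma {e \<in> E. reachable E u (fst e)} ?R"
  have fin: "finite ?I" using assms by simp
  have fst_lift: "fst (lift_edge (e, j)) = fst e @ [j]" for e j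
    by (cases e) (simp add: lift_edge_def)
  have "{e' \<in> lift_graph E. reachable (lift_graph E) (u @ [i]) (fst e')} \<subseteq> lift_edge ` ?I"
  proof
    fix e' assume "e' \<in> {e' \<in> lift_graph E. reachable (lift_graph E) (u @ [i]) (fst e')}"
    then obtain e j where "e \<in> E" "e' = lift_edge (e, j)" "reachable (lift_graph E) (u @ [i]) (fst e')"
      unfolding lift_graph_def by blast
    moreover from this have "reachable E u (fst e)" using fst_lift reachable_unlift by metis
    ultimately show "e' \<in> lift_edge ` ?I" using fst_lift by auto
  qed
  then have "component_weight (lift_graph E) (u @ [i]) \<le> (\<Sum>e' \<in> lift_edge ` ?I. edge_weight e')"
    unfolding component_weight_def using fin by (intro sum_mono2) auto
  also have "\<dots> \<le> (\<Sum>p \<in> ?I. edge_weight (lift_edge p))"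
    using sum_image_le[OF fin, of edge_weight lift_edge] by (simp add: o_def)
  also have "\<dots> = (\<Sum>e \<in> {e \<in> E. reachable E u (fst e)}. \<Sum>j \<in> ?R e. edge_weight (lift_edge (e, j)))"
    using assms by (subst sum.Sigma) auto
  finally show ?thesis .
qed

lemma sum_edge_weight_lift_le:
  "(\<Sum>j \<in> J. edge_weight (lift_edge (e, j))) \<le> edge_weight e"
  unfolding sum_edge_weight_lift[of e, symmetric] by (rule sum_mono2) auto

lemma component_weight_lift_le:
  assumes "finite E"
  shows "component_weight (lift_graph E) (u @ [i]) \<le> component_weight E u"
  unfolding component_weight_def[of E]
  by (rule order_trans[OF component_weight_lift_le_sum[OF assms]])
    (intro sum_mono sum_edge_weight_lift_le)

text \<open>If no loop at \<open>u\<close> moves the first level, then each vertex has at most one lift in the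
  component of \<open>u @ [i]\<close>. When that component carries the whole weight, the label of each of its
  edges has all its letters \<open>b\<close> on that lift, and such a section is a power of \<open>b\<close>.\<close>

lemma finite_holonomy_if_weight_eq:
  assumes fin: "finite E" and fixes_level: "\<And>w. walk E u w u \<Longrightarrow> aexp w = 0"
    and weight: "component_weight E u \<le> component_weight (lift_graph E) (u @ [i])"
  shows "finite (holonomy (lift_graph E) (u @ [i]))"
proof -
  let ?F = "lift_graph E" and ?p = "u @ [i]"
  have unique: "j = k" if r: "reachable ?F ?p (x @ [j])" "reachable ?F ?p (x @ [k])" for x j k
  proof -
    obtain w1 where w1: "walk E u w1 x" "j = i + aexp w1" using reachable_liftE[OF r(1)] .
    obtain w2 where w2: "walk E u w2 x" "k = i + aexp w2" using reachable_liftE[OF r(2)] .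
    have "aexp (w1 @ word_inv w2) = 0"
      using fixes_level walk_append[OF w1(1) walk_inv[OF w2(1)]] by blast
    with w1(2) w2(2) show ?thesis by simp
  qed
  have full: "blen (word_section w j) = blen w"
    if e: "(x, w, y) \<in> E" and j: "reachable ?F ?p (x @ [j])" for x w y j
  proof -
    let ?A = "{e \<in> E. reachable E u (fst e)}"
    let ?g = "\<lambda>e. \<Sum>j \<in> {j. reachable ?F ?p (fst e @ [j])}. edge_weight (lift_edge (e, j))"
    have "sum edge_weight ?A \<le> sum ?g ?A"
      using weight component_weight_lift_le_sum[OF fin, of u i] unfolding component_weight_def[of E]
      by (rule order_trans)
    then have eq: "sum ?g ?A = sum edge_weight ?A"
      by (rule antisym[OF sum_mono[OF sum_edge_weight_lift_le]])
    have "(x, w, y) \<in> ?A" using e reachable_unlift[OF j] by simp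
    \<comment> \<open>Termwise bounded sums that agree in total agree at each edge: no lift outside
      the component carries a letter \<open>b\<close>.\<close>
    then have "?g (x, w, y) = edge_weight (x, w, y)"
      by (rule sum_mono_inv[OF eq sum_edge_weight_lift_le]) (use fin in simp)
    moreover have "{k. reachable ?F ?p (x @ [k])} = {j}"
      using unique j by blast
    ultimately show ?thesis by (simp add: lift_edge_def edge_weight_def)
  qed
  have bpow: "\<exists>e. word_val w' = bpow e"
    if "walk ?F p w' q" "reachable ?F ?p p" for p w' q
    using that
  proof (induction rule: walk.induct)
    case (walk_Nil p)
    show ?case by (auto intro!: exI[of _ 0])
  next
    case (walk_forward p w1 p' w2 q)
    have "reachable ?F ?p p'"
      using walk_append walk_edge[OF walk_forward.hyps(1)] walk_forward.prems
      unfolding reachable_def by blast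
    then obtain e2 where e2: "word_val w2 = bpow e2" using walk_forward.IH by blast
    obtain x w y j where "(x, w, y) \<in> E" "p = x @ [j]" "w1 = word_section w j"
      using walk_forward.hyps(1) by (auto simp: lift_graph_iff)
    then have "word_val w1 = bpow (bexp w)"
      using full walk_forward.prems word_val_section_if_blen_eq by blast
    with e2 show ?case by (auto simp: bpow_add)
  next
    case (walk_backward p' w1 p w2 q)
    have p': "reachable ?F ?p p'"
      using walk_append walk_inv[OF walk_edge[OF walk_backward.hyps(1)]] walk_backward.prems
      unfolding reachable_def by blast
    then obtain e2 where e2: "word_val w2 = bpow e2" using walk_backward.IH by blast
    obtain x w y j where "(x, w, y) \<in> E" "p' = x @ [j]" "w1 = word_section w j"
      using walk_backward.hyps(1) by (auto simp: lift_graph_iff)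
    then have "word_val w1 = word_val [Lb (bexp w)]"
      using full p' word_val_section_if_blen_eq by auto
    from word_val_inv_cong[OF this] e2 show ?case by (auto simp: bpow_add)
  qed
  have "holonomy ?F ?p \<subseteq> range bpow"
    using bpow walk_Nil unfolding holonomy_def reachable_def by fast
  then show ?thesis by (rule finite_subset) simp
qed

text \<open>Elements fixing level 1 are determined by their three sections, so they embed in a
  finite product. The others form at most two further cosets, indexed by
  \<open>aexp\<close>.\<close>

lemma finite_if_finite_sections:
  assumes K: "gs_subgroup K" and fin: "\<And>i. finite (vertex_section K [i])"
  shows "finite K"
proof -
  let ?S = "\<lambda>k. {x \<in> K. \<exists>w. x = word_val w \<and> aexp w = k}"
  have "finite (?S 0)"
  proof (rule inj_on_finite)
    let ?f = "\<lambda>x i. section_at x [i]"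
    have sec: "section_at (word_val w) [i] = word_val (word_section w i)" for w i
      by (simp add: section_at_def word_val_Cons)
    show "inj_on ?f (?S 0)"
    proof (rule inj_onI)
      fix x y assume "x \<in> ?S 0" "y \<in> ?S 0" "?f x = ?f y"
      then obtain u w where "x = word_val u" "aexp u = 0" "y = word_val w" "aexp w = 0" by blast
      moreover from this have "word_val (word_section u i) = word_val (word_section w i)" for i
        using fun_cong[OF \<open>?f x = ?f y\<close>, of i] sec by simp
      ultimately show "x = y" using word_val_eqI[of u w] by simp
    qed
    show "?f ` ?S 0 \<subseteq> PiE UNIV (\<lambda>i. vertex_section K [i])"
    proof
      fix y assume "y \<in> ?f ` ?S 0"
      then obtain w where w: "y = ?f (word_val w)" "word_val w \<in> K" "aexp w = 0" by blast
      have "y i \<in> vertex_section K [i]" for i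
        using vertex_sectionI[OF K w(2,3) refl, of i] sec w(1) by simp
      then show "y \<in> PiE UNIV (\<lambda>i. vertex_section K [i])" by (rule PiE_I) simp
    qed
    show "finite (PiE (UNIV :: 3 set) (\<lambda>i. vertex_section K [i]))"
      by (rule finite_PiE) (simp_all add: fin)
  qed
  moreover have "finite (?S k)" if "finite (?S 0)" for k
  proof (cases "?S k = {}")
    case False
    then obtain w where w: "word_val w \<in> K" "aexp w = k" by blast
    have "?S k \<subseteq> (\<lambda>x. word_val w \<circ> x) ` ?S 0"
    proof
      fix x assume "x \<in> ?S k"
      then obtain u where u: "x = word_val u" "word_val u \<in> K" "aexp u = k" by blast
      have "word_val (u @ word_inv w) \<in> ?S 0"
        using gs_subgroup_append[OF K u(2) gs_subgroup_inv[OF K w(1)]] u(3) w(2)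
        by (intro CollectI conjI exI[of _ "u @ word_inv w"]) simp_all
      moreover have "x = word_val w \<circ> word_val (u @ word_inv w)"
        by (auto simp: u(1) word_val_inv')
      ultimately show "x \<in> (\<lambda>x. word_val w \<circ> x) ` ?S 0" by blast
    qed
    then show ?thesis using that by (rule finite_subset[OF _ finite_imageI])
  next
    case True
    then show ?thesis by (simp only: finite.emptyI)
  qed
  ultimately have "finite (\<Union>k. ?S k)" by (intro finite_UN_I) simp_all
  moreover have "K \<subseteq> (\<Union>k. ?S k)"
  proof
    fix x assume "x \<in> K"
    with gs_subgroupE[OF K] obtain w where "x = word_val w" by blast
    with \<open>x \<in> K\<close> have "x \<in> ?S (aexp w)" by blast
    then show "x \<in> (\<Union>k. ?S k)" by (rule UN_I[OF UNIV_I])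
  qed
  ultimately show ?thesis by (rule rev_finite_subset)
qed

section \<open>Infinite sections of minimal weight\<close>

lemma holonomy_eq_if_generated:
  assumes S: "finite S" "S \<subseteq> Gupta_Sidki"
  obtains E u where "finite E" "holonomy E u = generate Aut_T S"
proof -
  obtain W where W: "finite W" "S = word_val ` W"
    using S finite_subset_image unfolding Gupta_Sidki_eq_range by metis
  \<comment> \<open>One loop at the root for each generator: the Schreier graph of level 0.\<close>
  define E where "E = (\<lambda>w. ([] :: vertex, w, [] :: vertex)) ` W"
  have sub: "subgroup (generate Aut_T S) Aut_T"
    using group.generate_is_subgroup[OF group_Aut_T] S(2) subgroup.subset[OF subgroup_Gupta_Sidki]
    by blast
  then have gen: "gs_subgroup (generate Aut_T S)"
    using group.generate_subgroup_incl[OF group_Aut_T S(2) subgroup_Gupta_Sidki]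
    by (simp add: gs_subgroup_def)
  have "word_val w \<in> generate Aut_T S" if "walk E u w x" for u w x
    using that
  proof (induction rule: walk.induct)
    case (walk_Nil u)
    show ?case by (rule gs_subgroup_Nil[OF gen])
  next
    case (walk_forward u w v w' x)
    then have "word_val w \<in> generate Aut_T S"
      by (auto simp: E_def W(2) intro: generate.incl)
    then show ?case by (rule gs_subgroup_append[OF gen _ walk_forward.IH])
  next
    case (walk_backward v w u w' x)
    then have "word_val w \<in> generate Aut_T S"
      by (auto simp: E_def W(2) intro: generate.incl)
    then show ?case
      by (rule gs_subgroup_append[OF gen gs_subgroup_inv[OF gen] walk_backward.IH])
  qed
  then have "holonomy E [] \<subseteq> generate Aut_T S" unfolding holonomy_def by blast
  moreover have "S \<subseteq> holonomy E []"
  proof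
    fix x assume "x \<in> S"
    then obtain w where "w \<in> W" "x = word_val w" using W(2) by blast
    then show "x \<in> holonomy E []"
      using walk_edge[of "[]" w "[]" E] by (auto simp: holonomy_def E_def)
  qed
  then have "generate Aut_T S \<subseteq> holonomy E []"
    using group.generate_subgroup_incl[OF group_Aut_T] gs_subgroup_holonomy
    unfolding gs_subgroup_def by blast
  ultimately show ?thesis using that[of E "[]"] W(1) by (simp add: E_def)
qed

lemma exists_transitive_section:
  assumes S: "finite S" "S \<subseteq> Gupta_Sidki" and H: "H = generate Aut_T S" "gs_subgroup H"
    and inf: "infinite H"
  shows "\<exists>v i. level_transitive (vertex_section H v) \<and> level_transitive (vertex_section H (v @ [i]))"
proof -
  define P where "P n \<longleftrightarrow> (\<exists>E u v. finite E \<and> holonomy E u = vertex_section H v \<and>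
    infinite (holonomy E u) \<and> component_weight E u = n)" for n
  obtain E0 u0 where E0: "finite E0" "holonomy E0 u0 = H"
    using holonomy_eq_if_generated[OF S] H(1) by metis
  have "P (component_weight E0 u0)"
    unfolding P_def using E0 inf H(2) by (metis vertex_section_Nil)
  then obtain n where n: "P n" and minimal: "\<And>m. m < n \<Longrightarrow> \<not> P m"
    using exists_least_iff[of P] by blast
  obtain E u v where E: "finite E" "holonomy E u = vertex_section H v" "infinite (holonomy E u)"
    "component_weight E u = n"
    using n unfolding P_def by blast
  \<comment> \<open>Stated for every graph of minimal weight, since it is applied both to
    \<open>E\<close> and to a lift of \<open>E\<close> that is again minimal.\<close>
  have transitive: "level_transitive (holonomy E u)"
    if E: "finite E" "holonomy E u = vertex_section H v" "infinite (holonomy E u)"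
      "component_weight E u = n" for E u v
  proof (rule ccontr)
    assume "\<not> ?thesis"
    then have fixes_level: "aexp w = 0" if "walk E u w u" for w
      using that level_transitiveI[OF gs_subgroup_holonomy] unfolding holonomy_def by blast
    obtain i where i: "infinite (vertex_section (holonomy E u) [i])"
      using finite_if_finite_sections[OF gs_subgroup_holonomy] E(3) by blast
    have fin: "finite (lift_graph E)" using E(1) by (simp add: lift_graph_def)
    have "P (component_weight (lift_graph E) (u @ [i]))"
      unfolding P_def using fin i E(2) holonomy_lift vertex_section_append[OF H(2)] by metis
    \<comment> \<open>By minimality the infinite section one level lower cannot weigh less; without
      transitivity, keeping the whole weight would make that section finite.\<close>
    then have "component_weight E u \<le> component_weight (lift_graph E) (u @ [i])"
      using minimal E(4) by (meson not_le)
    then show False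
      using finite_holonomy_if_weight_eq[OF E(1) fixes_level] i holonomy_lift by metis
  qed
  obtain i where i: "infinite (vertex_section (holonomy E u) [i])"
    using finite_if_finite_sections[OF gs_subgroup_holonomy] E(3) by blast
  have fin: "finite (lift_graph E)" using E(1) by (simp add: lift_graph_def)
  have hol: "holonomy (lift_graph E) (u @ [i]) = vertex_section H (v @ [i])"
    using holonomy_lift E(2) vertex_section_append[OF H(2)] by metis
  have inf': "infinite (holonomy (lift_graph E) (u @ [i]))"
    using i holonomy_lift by metis
  have "P (component_weight (lift_graph E) (u @ [i]))"
    unfolding P_def using fin hol inf' by metis
  then have "component_weight (lift_graph E) (u @ [i]) = n"
    using minimal component_weight_lift_le[OF E(1)] E(4) by (metis le_neq_implies_less)
  then have "level_transitive (vertex_section H (v @ [i]))"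
    using transitive[OF fin hol inf'] hol by simp
  moreover have "level_transitive (vertex_section H v)"
    using transitive[OF E] E(2) by simp
  ultimately show ?thesis by blast
qed

theorem theorem3:
  fixes H :: "(vertex \<Rightarrow> vertex) set"
  assumes "finitely_generated_subgroup H Aut_T" and "H \<subseteq> Gupta_Sidki"
  shows "finite H \<longleftrightarrow> (\<forall>v. vertex_section H v \<noteq> Gupta_Sidki)"
proof
  assume "finite H"
  then have "finite (vertex_section H v)" for v
    unfolding vertex_section_def by simp
  then show "\<forall>v. vertex_section H v \<noteq> Gupta_Sidki"
    using infinite_Gupta_Sidki by metis
next
  assume none: "\<forall>v. vertex_section H v \<noteq> Gupta_Sidki"
  obtain S where S: "finite S" "S \<subseteq> H" "H = generate Aut_T S" and "subgroup H Aut_T"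
    using assms(1) unfolding finitely_generated_subgroup_def by blast
  then have H: "gs_subgroup H" using assms(2) by (simp add: gs_subgroup_def)
  show "finite H"
  proof (rule ccontr)
    assume "infinite H"
    then obtain v i where tr: "level_transitive (vertex_section H v)"
      "level_transitive (vertex_section H (v @ [i]))"
      using exists_transitive_section[OF S(1) _ S(3) H] S(2) assms(2) by blast
    let ?K = "vertex_section H v"
    have K: "gs_subgroup ?K" by (rule gs_subgroup_section[OF H])
    obtain u where "ab_surjective (vertex_section ?K u)"
      using exists_section_ab_surjective[OF K tr(1)] tr(2) vertex_section_append[OF H] by metis
    then obtain x where "vertex_section (vertex_section ?K u) x = Gupta_Sidki"
      using exists_section_eq_if_ab_surjective[OF gs_subgroup_section[OF K]] by blast
    then have "vertex_section H (v @ u @ x) = Gupta_Sidki"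
      by (simp add: vertex_section_append[OF H] vertex_section_append[OF K])
    with none show False by blast
  qed
qed

end
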